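(* Let $\Pi$ be a datalog program and let $\Pi'$ be the EDB-adorned program produced from $\Pi$ by the adornment algorithm (described in the context) with relaxation function $g_{\mathsf{out}}$ and membership checking function $h_{\mathsf{eq}}$. Then for every IDB predicate $q$ in $\Pi$, the integral edge-cover width of $q$ for $\Pi'$ is minimal over all EDB-bounded programs equivalent to $\Pi$: if $\Pi''$ is any EDB-bounded program equivalent to $\Pi$, and $\mathsf{ew}_{\Pi'}(q)$, $\mathsf{ew}_{\Pi''}(q)$ denote the integral edge-cover widths of $q$ in $\Pi'$ and $\Pi''$ respectively, then $\mathsf{ew}_{\Pi'}(q)\le\mathsf{ew}_{\Pi''}(q)$.
   Context: Datalog. Standard positive datalog programs: finite sets of rules $q(\bar s)\gets p_1(\bar s_1),\dots,p_\mu(\bar s_\mu)$ whose terms are variables or constants. A predicate is IDB if it is the head predicate of a rule with non-empty body, otherwise EDB. A rule is safe if every head variable occurs in the body. "$\_$" denotes a fresh existentially quantified variable (each occurrence distinct). $[\![q(\Pi,D)]\!]$ is the set of tuples $\bar s$ such that $q(\bar s)$ is in the least fixpoint of $\Pi$ on the EDB instance $D$. A ground atom is derived by rule $R$ over $D$ if it has a proof tree whose topmost rule application uses $R$. Adornments. An EDB-adorned atom is $q_\rho(\bar t)$, with $q$ an IDB predicate and $\rho$ (the adornment) a safe datalog rule whose head atom $A$ has predicate $q$, whose body atoms all have EDB predicates with arguments being variables or $\_$, and such that $q(\bar t)$ is an instance of $A$; $q_\rho$ is treated as a new predicate. An EDB-adorned program has only rules in which every atom is an EDB atom or an EDB-adorned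 IDB atom. It is EDB-bounded if for each rule $R$, with head predicate $q_\rho$ say, and every EDB $D$: whenever $q_\rho(\bar t)$ is derived by $R$ when evaluating the program over $D$, then $q(\bar t)$ is derived by the single-rule program $\{\rho\}$ over $D$. An EDB-bounded program $\Pi'$ is equivalent to a datalog program $\Pi$ if for every EDB $D$ and every IDB predicate $q$ in $\Pi$, $[\![q(\Pi,D)]\!]=\bigcup_\rho[\![q_\rho(\Pi',D)]\!]$. Edge-cover width. The hypergraph of an adornment $\rho: q(\bar s)\gets e_1(\bar t_1),\dots,e_\mu(\bar t_\mu)$ has as vertices the variables of the body and hyperedges $\mathsf{vars}(\bar t_i)$; the output variables are $V_{\mathsf{out}}=\mathsf{vars}(\bar s)$. The integral edge-cover width $\mathsf{ew}(q_\rho)=\mathsf{ew}(\rho)$ is the minimum number of hyperedges whose union contains $V_{\mathsf{out}}$. For an IDB predicate $q$ of $\Pi$, $\mathsf{ew}_{\Pi'}(q)$ is the maximum of $\mathsf{ew}(q_\rho)$ over all adorned predicates $q_\rho$ in $\Pi'$. Adornment algorithm (parameters $g$, $h$). Start with $\Pi'=\emptyset$. Repeat until a fixpoint for $\Pi'$: for each rule $R: q(\bar s)\gets \bigwedge_{i=1}^{\lambda}p_i(\bar s_i)\wedge\mathcal E$ of $\Pi$ ($p_i$ IDB predicates, $\mathcal E$ a conjunction of EDB atoms, $\lambda\ge 0$), and for each choice $(\rho_1,\dots,\rho_\lambda)$ such that for each $i$ some rule of $\Pi'$ has head atom ${p_i}_{\rho_i}(\bar v_i)$: rename variables in these head atoms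 together with their adornments, obtaining ${p_i}_{\rho_i'}(\bar v_i')$, so that $R$ and all these head atoms are variable-disjoint; write $\rho_i'$ as $p_i(\bar v_i')\gets\mathcal B_i$; let $\sigma$ be a simultaneous most general unifier of $\{(\bar s_i,\bar v_i')\mid 1\le i\le\lambda\}$ (if none exists, skip this choice); let $\rho_0$ be the rule $q(\sigma(\bar s))\gets\bigwedge_{i}\sigma(\mathcal B_i)\wedge\sigma(\mathcal E)$, let $\rho=g(\rho_0)$, and let $R'$ be $q_\rho(\sigma(\bar s))\gets\bigwedge_i {p_i}_{\rho_i}(\sigma(\bar s_i))\wedge\sigma(\mathcal E)$; if $h(R',\Pi')$ is false, add $R'$ to $\Pi'$. Output $\Pi'$. $g_{\mathsf{out}}$: in each body atom, replace every argument that does not occur in the rule head by $\_$; then remove every body atom $e(\bar t)$ for which there is another body atom $e(\bar t')$ such that for each position $i$ either $t_i=t_i'$ or $t_i=\_$ (of identical atoms one is kept); in particular, atoms with only $\_$ arguments are removed. $h_{\mathsf{eq}}(R',\Pi')$ is true iff $\Pi'$ contains a rule identical to $R'$ up to variable renaming. *)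

theory Defs
  imports Main "HOL-Library.Extended_Nat" "HOL-Library.Infinite_Typeclass"
begin

section \<open>Datalog\<close>

text \<open>\<open>Wild\<close> is the symbol ``\_'', a fresh existentially quantified variable at each occurrence.
  It is used in the bodies of adornments; in ordinary programs it is excluded by
  \<open>datalog_program\<close> (and \<open>edb_adorned_program\<close>), where a named variable takes its place.\<close>

datatype ('v, 'c) trm = Var 'v | Cst 'c | Wild

type_synonym ('p, 'v, 'c) atom = "'p \<times> ('v, 'c) trm list"

type_synonym ('p, 'c) fact = "'p \<times> 'c list"

datatype ('p, 'v, 'c) rule = Rule (head: "('p, 'v, 'c) atom") (body: "('p, 'v, 'c) atom list")

definition atoms :: "('p, 'v, 'c) rule \<Rightarrow> ('p, 'v, 'c) atom set" where
  "atoms R = insert (head R) (set (body R))"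

definition atom_vars :: "('p, 'v, 'c) atom \<Rightarrow> 'v set" where
  "atom_vars a = {x. Var x \<in> set (snd a)}"

definition rule_vars :: "('p, 'v, 'c) rule \<Rightarrow> 'v set" where
  "rule_vars R = \<Union> (atom_vars ` atoms R)"

definition preds :: "('p, 'v, 'c) rule set \<Rightarrow> 'p set" where
  "preds P = {p. \<exists>R\<in>P. p \<in> fst ` atoms R}"

definition idb :: "('p, 'v, 'c) rule set \<Rightarrow> 'p set" where
  "idb P = {fst (head R) | R. R \<in> P \<and> body R \<noteq> []}"

definition plain :: "('p, 'v, 'c) atom \<Rightarrow> bool" where
  "plain a \<longleftrightarrow> Wild \<notin> set (snd a)"

definition datalog_program :: "('p, 'v, 'c) rule set \<Rightarrow> bool" where
  "datalog_program P \<longleftrightarrow> finite P \<and> (\<forall>R\<in>P. \<forall>a\<in>atoms R. plain a)"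

definition safe :: "('p, 'v, 'c) rule \<Rightarrow> bool" where
  "safe R \<longleftrightarrow> atom_vars (head R) \<subseteq> \<Union> (atom_vars ` set (body R))"

subsection \<open>Semantics\<close>

fun match_trm :: "('v \<Rightarrow> 'c) \<Rightarrow> ('v, 'c) trm \<Rightarrow> 'c \<Rightarrow> bool" where
  "match_trm \<theta> (Var x) c \<longleftrightarrow> c = \<theta> x"
| "match_trm \<theta> (Cst d) c \<longleftrightarrow> c = d"
| "match_trm \<theta> Wild c \<longleftrightarrow> True"

definition matches :: "('v \<Rightarrow> 'c) \<Rightarrow> ('p, 'v, 'c) atom \<Rightarrow> ('p, 'c) fact \<Rightarrow> bool" where
  "matches \<theta> a f \<longleftrightarrow> fst a = fst f \<and> list_all2 (match_trm \<theta>) (snd a) (snd f)"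

text \<open>The least fixpoint of \<open>P\<close> on \<open>D\<close>, including the facts of \<open>D\<close>.\<close>

inductive_set model :: "('p, 'v, 'c) rule set \<Rightarrow> ('p, 'c) fact set \<Rightarrow> ('p, 'c) fact set"
  for P :: "('p, 'v, 'c) rule set" and D :: "('p, 'c) fact set" where
  edb: "f \<in> D \<Longrightarrow> f \<in> model P D"
| rule: "R \<in> P \<Longrightarrow> matches \<theta> (head R) f \<Longrightarrow>
    (\<forall>a\<in>set (body R). \<exists>f'. f' \<in> model P D \<and> matches \<theta> a f') \<Longrightarrow> f \<in> model P D"

definition answers :: "'p \<Rightarrow> ('p, 'v, 'c) rule set \<Rightarrow> ('p, 'c) fact set \<Rightarrow> 'c list set" where
  "answers q P D = {cs. (q, cs) \<in> model P D}"

text \<open>\<open>f\<close> has a proof tree over \<open>D\<close> whose topmost rule application uses \<open>R\<close>.\<close>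

definition derived_by ::
    "('p, 'v, 'c) rule set \<Rightarrow> ('p, 'c) fact set \<Rightarrow> ('p, 'v, 'c) rule \<Rightarrow> ('p, 'c) fact \<Rightarrow> bool" where
  "derived_by P D R f \<longleftrightarrow> R \<in> P \<and>
     (\<exists>\<theta>. matches \<theta> (head R) f \<and> (\<forall>a\<in>set (body R). \<exists>f'\<in>model P D. matches \<theta> a f'))"

text \<open>\<open>E\<close> is the set of EDB predicates. It contains the EDB predicates of \<open>P\<close>, and may leave out
  predicates not occurring in \<open>P\<close>, so that adorned programs equivalent to \<open>P\<close> may use auxiliary
  IDB predicates.\<close>

definition edb_schema :: "'p set \<Rightarrow> ('p, 'v, 'c) rule set \<Rightarrow> bool" where
  "edb_schema E P \<longleftrightarrow> E \<inter> idb P = {} \<and> preds P - idb P \<subseteq> E"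

definition edb_instance :: "'p set \<Rightarrow> ('p, 'c) fact set \<Rightarrow> bool" where
  "edb_instance E D \<longleftrightarrow> finite D \<and> fst ` D \<subseteq> E"

subsection \<open>Substitutions, variants and unifiers\<close>

fun subst :: "('v \<Rightarrow> ('w, 'c) trm) \<Rightarrow> ('v, 'c) trm \<Rightarrow> ('w, 'c) trm" where
  "subst \<sigma> (Var x) = \<sigma> x"
| "subst \<sigma> (Cst c) = Cst c"
| "subst \<sigma> Wild = Wild"

definition subst_atom :: "('v \<Rightarrow> ('w, 'c) trm) \<Rightarrow> ('p, 'v, 'c) atom \<Rightarrow> ('p, 'w, 'c) atom" where
  "subst_atom \<sigma> a = (fst a, map (subst \<sigma>) (snd a))"

text \<open>Identity of rules up to variable renaming. Bodies are conjunctions, so they are compared as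
  sets of atoms.\<close>

definition variant :: "('p, 'v, 'c) rule \<Rightarrow> ('p, 'v, 'c) rule \<Rightarrow> bool" where
  "variant R R' \<longleftrightarrow> (\<exists>\<pi>. bij \<pi> \<and> head R' = subst_atom (Var \<circ> \<pi>) (head R) \<and>
     set (body R') = subst_atom (Var \<circ> \<pi>) ` set (body R))"

lemma subst_Var: "subst Var t = t"
  by (cases t) auto

lemma subst_atom_Var: "subst_atom Var = id"
  by (rule ext) (simp add: subst_atom_def subst_Var cong: map_cong)

lemma subst_comp: "subst \<tau> (subst \<sigma> t) = subst (subst \<tau> \<circ> \<sigma>) t"
  by (cases t) auto

lemma subst_atom_comp: "subst_atom (Var \<circ> \<rho>) (subst_atom (Var \<circ> \<pi>) a) = subst_atom (Var \<circ> (\<rho> \<circ> \<pi>)) a"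
  by (auto simp: subst_atom_def subst_comp intro!: arg_cong[where f = "\<lambda>s. subst s t" for t])

lemma equivp_variant: "equivp (variant :: ('p, 'v, 'c) rule \<Rightarrow> _)"
proof (rule equivpI)
  show "reflp (variant :: ('p, 'v, 'c) rule \<Rightarrow> _)"
  proof (rule reflpI)
    fix R :: "('p, 'v, 'c) rule"
    show "variant R R"
      unfolding variant_def
      by (rule exI[of _ id]) (simp add: subst_atom_Var)
  qed
  show "symp (variant :: ('p, 'v, 'c) rule \<Rightarrow> _)"
  proof (rule sympI)
    fix R R' :: "('p, 'v, 'c) rule"
    assume "variant R R'"
    then obtain \<pi> where \<pi>: "bij \<pi>" "head R' = subst_atom (Var \<circ> \<pi>) (head R)"
      "set (body R') = subst_atom (Var \<circ> \<pi>) ` set (body R)"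
      unfolding variant_def by blast
    have inv: "subst_atom (Var \<circ> inv \<pi>) (subst_atom (Var \<circ> \<pi>) a) = a" for a :: "('p, 'v, 'c) atom"
      unfolding subst_atom_comp inv_o_cancel[OF bij_is_inj[OF \<pi>(1)]] by (simp add: subst_atom_Var)
    show "variant R' R"
      unfolding variant_def
      by (rule exI[of _ "inv \<pi>"]) (simp add: \<pi> bij_imp_bij_inv inv image_image del: comp_apply)
  qed
  show "transp (variant :: ('p, 'v, 'c) rule \<Rightarrow> _)"
  proof (rule transpI)
    fix R S T :: "('p, 'v, 'c) rule"
    assume "variant R S" "variant S T"
    then obtain \<pi> \<rho> where
      "bij \<pi>" "head S = subst_atom (Var \<circ> \<pi>) (head R)"
      "set (body S) = subst_atom (Var \<circ> \<pi>) ` set (body R)"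
      "bij \<rho>" "head T = subst_atom (Var \<circ> \<rho>) (head S)"
      "set (body T) = subst_atom (Var \<circ> \<rho>) ` set (body S)"
      unfolding variant_def by blast
    then show "variant R T"
      unfolding variant_def
      by (intro exI[of _ "\<rho> \<circ> \<pi>"]) (simp add: bij_comp subst_atom_comp image_image del: comp_apply)
  qed
qed

definition unifier ::
    "('v \<Rightarrow> ('v, 'c) trm) \<Rightarrow> (('v, 'c) trm list \<times> ('v, 'c) trm list) set \<Rightarrow> bool" where
  "unifier \<sigma> U \<longleftrightarrow> (\<forall>x. \<sigma> x \<noteq> Wild) \<and> (\<forall>(ss, ts)\<in>U. map (subst \<sigma>) ss = map (subst \<sigma>) ts)"

definition mgu ::
    "('v \<Rightarrow> ('v, 'c) trm) \<Rightarrow> (('v, 'c) trm list \<times> ('v, 'c) trm list) set \<Rightarrow> bool" where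
  "mgu \<sigma> U \<longleftrightarrow> unifier \<sigma> U \<and> (\<forall>\<tau>. unifier \<tau> U \<longrightarrow> (\<exists>\<delta>. \<forall>x. \<tau> x = subst \<delta> (\<sigma> x)))"

section \<open>EDB-adorned programs\<close>

text \<open>Adornments are rules up to variable renaming: \<open>adorn \<rho>\<close> is the class of \<open>\<rho>\<close>. The adorned
  predicate \<open>q\<^sub>\<rho>\<close> is \<open>Adorned (adorn \<rho>)\<close>; here \<open>q\<close> is the head predicate of \<open>\<rho>\<close>. Quantifying over
  the rules \<open>\<rho>\<close> with a given \<open>adorn \<rho>\<close> amounts to choosing names for the variables of the
  adornment.\<close>

quotient_type ('p, 'v, 'c) adornment = "('p, 'v, 'c) rule" / variant
  morphisms rep_adornment adorn
  by (rule equivp_variant)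

datatype ('p, 'v, 'c) apred = Edb 'p | Adorned "('p, 'v, 'c) adornment"

type_synonym ('p, 'v, 'c) arule = "(('p, 'v, 'c) apred, 'v, 'c) rule"

definition valid_adornment :: "'p set \<Rightarrow> ('p, 'v, 'c) rule \<Rightarrow> bool" where
  "valid_adornment E \<rho> \<longleftrightarrow> safe \<rho> \<and> fst (head \<rho>) \<notin> E \<and> plain (head \<rho>) \<and>
     (\<forall>(e, ts)\<in>set (body \<rho>). e \<in> E \<and> (\<forall>t\<in>set ts. t = Wild \<or> (\<exists>x. t = Var x)))"

definition edb_adorned_atom :: "'p set \<Rightarrow> (('p, 'v, 'c) apred, 'v, 'c) atom \<Rightarrow> bool" where
  "edb_adorned_atom E a \<longleftrightarrow> (\<exists>\<rho> \<sigma>. fst a = Adorned (adorn \<rho>) \<and> valid_adornment E \<rho> \<and>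
     snd a = map (subst \<sigma>) (snd (head \<rho>)))"

text \<open>An EDB predicate is not the head predicate of a rule with non-empty body, hence the last
  conjunct.\<close>

definition edb_adorned_program :: "'p set \<Rightarrow> ('p, 'v, 'c) arule set \<Rightarrow> bool" where
  "edb_adorned_program E P \<longleftrightarrow> datalog_program P \<and>
     (\<forall>R\<in>P. (\<forall>a\<in>atoms R. fst a \<in> Edb ` E \<or> edb_adorned_atom E a)) \<and>
     (\<forall>R\<in>P. fst (head R) \<in> Edb ` E \<longrightarrow> body R = [])"

definition edb_facts :: "('p, 'c) fact set \<Rightarrow> (('p, 'v, 'c) apred, 'c) fact set" where
  "edb_facts D = (\<lambda>(e, cs). (Edb e, cs)) ` D"

definition edb_bounded :: "'p set \<Rightarrow> ('p, 'v, 'c) arule set \<Rightarrow> bool" where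
  "edb_bounded E P \<longleftrightarrow> edb_adorned_program E P \<and>
     (\<forall>R\<in>P. \<forall>\<rho>. fst (head R) = Adorned (adorn \<rho>) \<longrightarrow>
        (\<forall>D cs. edb_instance E D \<longrightarrow>
           derived_by P (edb_facts D) R (Adorned (adorn \<rho>), cs) \<longrightarrow>
           cs \<in> answers (fst (head \<rho>)) {\<rho>} D))"

definition equivalent :: "'p set \<Rightarrow> ('p, 'v, 'c) arule set \<Rightarrow> ('p, 'v, 'c) rule set \<Rightarrow> bool" where
  "equivalent E P' P \<longleftrightarrow> (\<forall>D. edb_instance E D \<longrightarrow> (\<forall>q\<in>idb P.
     answers q P D = (\<Union>\<rho>\<in>{\<rho>. fst (head \<rho>) = q}. answers (Adorned (adorn \<rho>)) P' (edb_facts D))))"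

subsection \<open>Integral edge-cover width\<close>

definition hyperedges :: "('p, 'v, 'c) rule \<Rightarrow> 'v set set" where
  "hyperedges \<rho> = atom_vars ` set (body \<rho>)"

text \<open>The value is \<open>\<infinity>\<close> exactly if there is no cover, i.e. if \<open>\<rho>\<close> is not safe.\<close>

definition ew :: "('p, 'v, 'c) rule \<Rightarrow> enat" where
  "ew \<rho> = (INF F\<in>{F. F \<subseteq> hyperedges \<rho> \<and> atom_vars (head \<rho>) \<subseteq> \<Union> F}. enat (card F))"

text \<open>The value is \<open>0\<close> if no adorned version of \<open>q\<close> occurs in \<open>P\<close>.\<close>

definition ew_program :: "('p, 'v, 'c) arule set \<Rightarrow> 'p \<Rightarrow> enat" where
  "ew_program P q = (SUP \<rho>\<in>{\<rho>. Adorned (adorn \<rho>) \<in> preds P \<and> fst (head \<rho>) = q}. ew \<rho>)"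

section \<open>The adornment algorithm\<close>

text \<open>The rules \<open>R'\<close> constructed from \<open>P\<close> and the current program \<open>P'\<close>. The list \<open>\<rho>s\<close> contains the
  renamed adornments; the premises on \<open>\<sigma>\<close> and on disjointness allow any renaming and any most
  general unifier.\<close>

inductive candidate ::
    "(('p, 'v, 'c) rule \<Rightarrow> ('p, 'v, 'c) rule) \<Rightarrow> ('p, 'v, 'c) rule set \<Rightarrow> ('p, 'v, 'c) arule set \<Rightarrow>
     ('p, 'v, 'c) arule \<Rightarrow> bool"
  for g P P' where
  "R \<in> P \<Longrightarrow>
   as = filter (\<lambda>a. fst a \<in> idb P) (body R) \<Longrightarrow>
   es = filter (\<lambda>a. fst a \<notin> idb P) (body R) \<Longrightarrow>
   list_all2 (\<lambda>a \<rho>. fst (head \<rho>) = fst a \<and> (\<exists>R\<^sub>1\<in>P'. fst (head R\<^sub>1) = Adorned (adorn \<rho>))) as \<rho>s \<Longrightarrow>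
   sorted_wrt (\<lambda>r r'. rule_vars r \<inter> rule_vars r' = {}) (R # \<rho>s) \<Longrightarrow>
   mgu \<sigma> (set (zip (map snd as) (map (\<lambda>\<rho>. snd (head \<rho>)) \<rho>s))) \<Longrightarrow>
   \<rho>\<^sub>0 = Rule (subst_atom \<sigma> (head R)) (map (subst_atom \<sigma>) (concat (map body \<rho>s) @ es)) \<Longrightarrow>
   R' = Rule (Adorned (adorn (g \<rho>\<^sub>0)), map (subst \<sigma>) (snd (head R)))
     (map2 (\<lambda>\<rho> a. (Adorned (adorn \<rho>), map (subst \<sigma>) (snd a))) \<rho>s as @
      map (\<lambda>a. (Edb (fst a), map (subst \<sigma>) (snd a))) es) \<Longrightarrow>
   candidate g P P' R'"

definition adornment_step ::
    "(('p, 'v, 'c) rule \<Rightarrow> ('p, 'v, 'c) rule) \<Rightarrow>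
     (('p, 'v, 'c) arule \<Rightarrow> ('p, 'v, 'c) arule set \<Rightarrow> bool) \<Rightarrow>
     ('p, 'v, 'c) rule set \<Rightarrow> ('p, 'v, 'c) arule set \<Rightarrow> ('p, 'v, 'c) arule set \<Rightarrow> bool" where
  "adornment_step g h P P' Q \<longleftrightarrow> (\<exists>R'. candidate g P P' R' \<and> \<not> h R' P' \<and> Q = insert R' P')"

text \<open>\<open>P'\<close> is the result of a terminating run of the algorithm on \<open>P\<close>.\<close>

definition adornment_output ::
    "(('p, 'v, 'c) rule \<Rightarrow> ('p, 'v, 'c) rule) \<Rightarrow>
     (('p, 'v, 'c) arule \<Rightarrow> ('p, 'v, 'c) arule set \<Rightarrow> bool) \<Rightarrow>
     ('p, 'v, 'c) rule set \<Rightarrow> ('p, 'v, 'c) arule set \<Rightarrow> bool" where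
  "adornment_output g h P P' \<longleftrightarrow>
     (adornment_step g h P)\<^sup>*\<^sup>* {} P' \<and> \<not> (\<exists>Q. adornment_step g h P P' Q)"

definition subsumed :: "('p, 'v, 'c) atom \<Rightarrow> ('p, 'v, 'c) atom \<Rightarrow> bool" where
  "subsumed a a' \<longleftrightarrow> fst a = fst a' \<and> list_all2 (\<lambda>t t'. t = t' \<or> t = Wild) (snd a) (snd a')"

text \<open>Atoms all of whose arguments are \<open>Wild\<close> are removed even if they are the only ones with
  their predicate.\<close>

definition g_out :: "('p, 'v, 'c) rule \<Rightarrow> ('p, 'v, 'c) rule" where
  "g_out \<rho> =
    (let relax = (\<lambda>t. if t \<in> set (snd (head \<rho>)) then t else Wild);
         as = remdups (map (\<lambda>a. (fst a, map relax (snd a))) (body \<rho>))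
     in Rule (head \<rho>) (filter (\<lambda>a. \<not> (\<forall>t\<in>set (snd a). t = Wild) \<and>
          \<not> (\<exists>a'\<in>set as. a' \<noteq> a \<and> subsumed a a')) as))"

definition h_eq :: "('p, 'v, 'c) arule \<Rightarrow> ('p, 'v, 'c) arule set \<Rightarrow> bool" where
  "h_eq R' P' \<longleftrightarrow> (\<exists>R\<in>P'. variant R R')"

end

theory Submission
  imports Defs
begin

text \<open>Fix an adornment \<open>\<rho>\<close> produced by the algorithm. Following its construction, every valuation of
  its head variables comes with an EDB instance over which \<open>P\<close> derives the head; the variables
  lost by relaxation can all be sent to a single dummy constant \<open>d\<close>, and then every fact of the
  instance contains, up to \<open>d\<close> and finitely many constants of the programs, only values of
  variables of one hyperedge of \<open>\<rho>\<close>. Take the valuation injective and fresh for the competing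
  program. The competitor derives the same head by some adornment \<open>\<rho>''\<close>, which by EDB-boundedness
  matches in the instance. An edge cover of \<open>\<rho>''\<close> thus turns into facts containing all head values,
  and hence into an edge cover of \<open>\<rho>\<close> that is no larger.\<close>

section \<open>Ground instances of atoms\<close>

fun inst :: "('v \<Rightarrow> 'c) \<Rightarrow> 'c \<Rightarrow> ('v, 'c) trm \<Rightarrow> 'c" where
  "inst \<theta> d (Var x) = \<theta> x"
| "inst \<theta> d (Cst c) = c"
| "inst \<theta> d Wild = d"

definition inst_atom :: "('v \<Rightarrow> 'c) \<Rightarrow> 'c \<Rightarrow> ('p, 'v, 'c) atom \<Rightarrow> ('p, 'c) fact" where
  "inst_atom \<theta> d a = (fst a, map (inst \<theta> d) (snd a))"

lemma inst_subst: "inst \<theta> d (subst \<sigma> t) = inst (\<lambda>x. inst \<theta> d (\<sigma> x)) d t"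
  by (cases t) auto

lemma inst_atom_subst_atom:
  "inst_atom \<theta> d (subst_atom \<sigma> a) = inst_atom (\<lambda>x. inst \<theta> d (\<sigma> x)) d a"
  by (simp add: inst_atom_def subst_atom_def inst_subst)

lemma inst_cong: "(\<And>x. t = Var x \<Longrightarrow> \<theta> x = \<theta>' x) \<Longrightarrow> inst \<theta> d t = inst \<theta>' d t"
  by (cases t) auto

lemma inst_atom_cong:
  "(\<And>x. x \<in> atom_vars a \<Longrightarrow> \<theta> x = \<theta>' x) \<Longrightarrow> inst_atom \<theta> d a = inst_atom \<theta>' d a"
  by (auto simp: inst_atom_def atom_vars_def intro!: inst_cong)

text \<open>Matching accepts any constant at a wildcard, so filling it with \<open>d\<close> is
  harmless. This turns a body atom into one concrete fact that can be put into an instance.\<close>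

lemma matches_inst_atom: "matches \<theta> a (inst_atom \<theta> d a)"
proof -
  have "match_trm \<theta> t (inst \<theta> d t)" for t
    by (cases t) auto
  then show ?thesis
    by (simp add: matches_def inst_atom_def list_all2_conv_all_nth)
qed

lemma matches_nth:
  "matches \<theta> a f \<Longrightarrow> i < length (snd f) \<Longrightarrow> i < length (snd a) \<and> match_trm \<theta> (snd a ! i) (snd f ! i)"
  by (auto simp: matches_def list_all2_conv_all_nth)

lemma matches_var: "matches \<theta> a f \<Longrightarrow> x \<in> atom_vars a \<Longrightarrow> \<theta> x \<in> set (snd f)"
  by (fastforce simp: matches_def list_all2_conv_all_nth atom_vars_def in_set_conv_nth)

lemma atom_vars_subst_Var:
  fixes a :: "('p, 'v, 'c) atom"
  shows "atom_vars (subst_atom (Var \<circ> \<pi>) a) = \<pi> ` atom_vars a"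
proof -
  have "Var y = subst (Var \<circ> \<pi>) t \<longleftrightarrow> (\<exists>x. t = Var x \<and> y = \<pi> x)" for t :: "('v, 'c) trm" and y
    by (cases t) auto
  then show ?thesis
    by (auto simp: atom_vars_def subst_atom_def image_iff)
qed

lemma finite_atom_vars: "finite (atom_vars a)"
proof -
  have "atom_vars a = Var -` set (snd a)"
    by (auto simp: atom_vars_def)
  then show ?thesis
    by (simp add: finite_vimageI inj_on_def)
qed

lemma finite_rule_vars: "finite (rule_vars R)"
  by (simp add: rule_vars_def atoms_def finite_atom_vars)

lemma finite_consts: "finite {c. Cst c \<in> set (snd a)}"
  using finite_vimageI[of "set (snd a)" Cst] by (simp add: vimage_def inj_on_def)

lemma model_mono: "D \<subseteq> D' \<Longrightarrow> f \<in> model P D \<Longrightarrow> f \<in> model P D'"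
proof -
  assume "f \<in> model P D" and sub: "D \<subseteq> D'"
  from this(1) show ?thesis
  proof induction
    case (edb f)
    with sub show ?case
      by (auto intro: model.edb)
  next
    case (rule R \<theta> f)
    from rule(3) have "\<forall>a\<in>set (body R). \<exists>f'. f' \<in> model P D' \<and> matches \<theta> a f'"
      by blast
    with rule(1,2) show ?case
      by (rule model.rule)
  qed
qed

section \<open>Subsumption order and the relaxation \<open>g_out\<close>\<close>

lemma subsumed_atom_vars: "subsumed a b \<Longrightarrow> atom_vars a \<subseteq> atom_vars b"
  by (fastforce simp: subsumed_def list_all2_conv_all_nth atom_vars_def in_set_conv_nth)

lemma subsumed_refl: "subsumed a a"
  by (simp add: subsumed_def list_all2_conv_all_nth)

lemma subsumed_trans: "subsumed a b \<Longrightarrow> subsumed b c \<Longrightarrow> subsumed a c"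
  by (fastforce simp: subsumed_def list_all2_conv_all_nth)

text \<open>Where two arguments differ, each would have to be \<open>Wild\<close>. Subsumption is
  therefore a partial order, and finite nonempty sets of atoms have maximal elements.\<close>

lemma subsumed_antisym: "subsumed a b \<Longrightarrow> subsumed b a \<Longrightarrow> a = b"
  by (fastforce simp: subsumed_def list_all2_conv_all_nth prod_eq_iff intro: nth_equalityI)

lemma head_g_out [simp]: "head (g_out \<rho>) = head \<rho>"
  by (simp add: g_out_def Let_def)

text \<open>An atom is deleted only in favour of a less relaxed one, or because all its arguments
  are wildcards. The default \<open>{}\<close> covers the latter case, in which there is no head
  variable to keep.\<close>

lemma g_out_keeps_head_vars:
  assumes "a \<in> set (body \<rho>)"
  shows "\<exists>V\<in>insert {} (hyperedges (g_out \<rho>)). atom_vars a \<inter> atom_vars (head \<rho>) \<subseteq> V"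
proof -
  define relax where "relax = (\<lambda>t. if t \<in> set (snd (head \<rho>)) then t else Wild)"
  define as where "as = remdups (map (\<lambda>a. (fst a, map relax (snd a))) (body \<rho>))"
  have body: "set (body (g_out \<rho>)) = {b \<in> set as. \<not> (\<forall>t\<in>set (snd b). t = Wild) \<and>
      \<not> (\<exists>b'\<in>set as. b' \<noteq> b \<and> subsumed b b')}"
    by (auto simp: g_out_def Let_def relax_def as_def)
  define r where "r = (fst a, map relax (snd a))"
  define A where "A = {b \<in> set as. subsumed r b}"
  have "r \<in> A"
    using assms by (auto simp: A_def as_def r_def subsumed_refl)
  moreover have "finite A"
    by (simp add: A_def)
  \<comment> \<open>The atom that subsumes \<open>r\<close> may itself be deleted, so a maximal atom
    above \<open>r\<close> is taken at once; no other atom of \<open>as\<close> subsumes it.\<close>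
  ultimately obtain m where m: "m \<in> A" "\<forall>b\<in>A. b \<noteq> m \<longrightarrow> \<not> subsumed m b"
    using Finite_Set.bex_max_element[of A "\<lambda>b b'. b \<noteq> b' \<and> subsumed b b'"]
    by (fastforce intro: asymp_onI transp_onI dest: subsumed_trans subsumed_antisym)
  have "atom_vars a \<inter> atom_vars (head \<rho>) \<subseteq> atom_vars r"
    by (force simp: atom_vars_def r_def relax_def)
  also have "\<dots> \<subseteq> atom_vars m"
    using m(1) by (simp add: A_def subsumed_atom_vars)
  finally have sub: "atom_vars a \<inter> atom_vars (head \<rho>) \<subseteq> atom_vars m" .
  show ?thesis
  proof (cases "\<forall>t\<in>set (snd m). t = Wild")
    case True
    then have "atom_vars m = {}"
      by (auto simp: atom_vars_def)
    with sub show ?thesis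
      by auto
  next
    case False
    then have "m \<in> set (body (g_out \<rho>))"
      using m by (auto simp: body A_def dest: subsumed_trans)
    with sub show ?thesis
      by (auto simp: hyperedges_def)
  qed
qed

section \<open>Realizability as an invariant of the algorithm\<close>

text \<open>The finite set \<open>C\<close> is fixed before \<open>\<theta>\<close> and
  \<open>d\<close>, so that both can later be chosen with \<open>C\<close> known. The alternative
  \<open>{}\<close> for \<open>V\<close> is for facts that show no head variable at all.\<close>

definition realizable :: "'p set \<Rightarrow> ('p, 'v, 'c) rule set \<Rightarrow> ('p, 'v, 'c) rule \<Rightarrow> bool" where
  "realizable E P \<rho> \<longleftrightarrow> (\<exists>C. finite C \<and> (\<forall>\<theta> d. \<exists>D. edb_instance E D \<and>
     inst_atom \<theta> d (head \<rho>) \<in> model P D \<and>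
     (\<forall>f\<in>D. \<exists>V\<in>insert {} (hyperedges \<rho>). set (snd f) \<subseteq> insert d (C \<union> \<theta> ` V))))"

text \<open>Adorned predicates are renaming classes, so the invariant has to be independent of the
  representative: a valuation \<open>\<theta>\<close> of the renamed rule acts on the original one
  as \<open>\<theta> \<circ> \<pi>\<close>.\<close>

lemma realizable_variant:
  fixes \<rho> \<rho>' :: "('p, 'v, 'c) rule"
  assumes "variant \<rho> \<rho>'" and "realizable E P \<rho>"
  shows "realizable E P \<rho>'"
proof -
  obtain \<pi> where \<pi>: "head \<rho>' = subst_atom (Var \<circ> \<pi>) (head \<rho>)"
    "set (body \<rho>') = subst_atom (Var \<circ> \<pi>) ` set (body \<rho>)"
    using assms(1) unfolding variant_def by blast
  obtain C where C: "finite C" "\<And>\<theta> d. \<exists>D. edb_instance E D \<and>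
     inst_atom \<theta> d (head \<rho>) \<in> model P D \<and>
     (\<forall>f\<in>D. \<exists>V\<in>insert {} (hyperedges \<rho>). set (snd f) \<subseteq> insert d (C \<union> \<theta> ` V))"
    using assms(2) unfolding realizable_def by blast
  have hyp: "hyperedges \<rho>' = (`) \<pi> ` hyperedges \<rho>"
    by (auto simp: hyperedges_def \<pi>(2) image_image atom_vars_subst_Var)
  have head: "inst_atom \<theta> d (head \<rho>') = inst_atom (\<theta> \<circ> \<pi>) d (head \<rho>)" for \<theta> d
    by (simp add: \<pi>(1) inst_atom_subst_atom comp_def)
  show ?thesis
    unfolding realizable_def
  proof (intro exI[of _ C] conjI allI C(1))
    fix \<theta> :: "'v \<Rightarrow> 'c" and d
    obtain D where D: "edb_instance E D" "inst_atom (\<theta> \<circ> \<pi>) d (head \<rho>) \<in> model P D"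
      "\<forall>f\<in>D. \<exists>V\<in>insert {} (hyperedges \<rho>). set (snd f) \<subseteq> insert d (C \<union> (\<theta> \<circ> \<pi>) ` V)"
      using C(2) by blast
    have "\<exists>V\<in>insert {} (hyperedges \<rho>'). set (snd f) \<subseteq> insert d (C \<union> \<theta> ` V)"
      if f: "f \<in> D" for f
    proof -
      obtain V where "V \<in> insert {} (hyperedges \<rho>)" "set (snd f) \<subseteq> insert d (C \<union> (\<theta> \<circ> \<pi>) ` V)"
        using D(3) f by blast
      then show ?thesis
        by (intro bexI[of _ "\<pi> ` V"]) (auto simp: hyp image_image)
    qed
    then show "\<exists>D. edb_instance E D \<and> inst_atom \<theta> d (head \<rho>') \<in> model P D \<and>
      (\<forall>f\<in>D. \<exists>V\<in>insert {} (hyperedges \<rho>'). set (snd f) \<subseteq> insert d (C \<union> \<theta> ` V))"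
      using D(1,2) by (intro exI[of _ D]) (simp add: head)
  qed
qed

text \<open>The inductive step. The instances realizing the \<open>\<rho>s\<close>, joined with the
  instantiated EDB atoms of \<open>R\<close>, form the new instance. Unification makes the IDB body
  atoms of \<open>R\<close> agree with the heads of the \<open>\<rho>s\<close>, so \<open>R\<close>
  fires on it.\<close>

lemma realizable_g_out:
  fixes P :: "('p, 'v, 'c) rule set"
  assumes schema: "edb_schema E P" and R: "R \<in> P"
    and as: "as = filter (\<lambda>a. fst a \<in> idb P) (body R)"
    and es: "es = filter (\<lambda>a. fst a \<notin> idb P) (body R)"
    and \<rho>s: "list_all2 (\<lambda>a \<rho>. fst (head \<rho>) = fst a \<and> realizable E P \<rho>) as \<rho>s"
    and unif: "unifier \<sigma> (set (zip (map snd as) (map (\<lambda>\<rho>. snd (head \<rho>)) \<rho>s)))"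
    and \<rho>\<^sub>0: "\<rho>\<^sub>0 = Rule (subst_atom \<sigma> (head R)) (map (subst_atom \<sigma>) (concat (map body \<rho>s) @ es))"
  shows "realizable E P (g_out \<rho>\<^sub>0)"
proof -
  have "\<forall>\<rho>\<in>set \<rho>s. realizable E P \<rho>"
    using \<rho>s by (auto simp: list_all2_conv_all_nth in_set_conv_nth)
  then obtain C where C: "\<And>\<rho>. \<rho> \<in> set \<rho>s \<Longrightarrow> finite (C \<rho>)"
    "\<And>\<rho> \<theta> d. \<rho> \<in> set \<rho>s \<Longrightarrow> \<exists>D. edb_instance E D \<and> inst_atom \<theta> d (head \<rho>) \<in> model P D \<and>
     (\<forall>f\<in>D. \<exists>V\<in>insert {} (hyperedges \<rho>). set (snd f) \<subseteq> insert d (C \<rho> \<union> \<theta> ` V))"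
    unfolding realizable_def by metis
  \<comment> \<open>Besides the constants of the earlier adornments, \<open>\<sigma>\<close> may put
    constants into the body of \<open>\<rho>\<^sub>0\<close>; none of them depends on
    \<open>\<theta>\<close> or \<open>d\<close>.\<close>
  define K where "K = (\<Union>\<rho>\<in>set \<rho>s. C \<rho>) \<union> (\<Union>a\<in>set (body \<rho>\<^sub>0). {c. Cst c \<in> set (snd a)})"
  have "finite K"
    by (auto simp: K_def C(1) finite_consts)
  moreover have "\<exists>D. edb_instance E D \<and> inst_atom \<theta> d (head (g_out \<rho>\<^sub>0)) \<in> model P D \<and>
     (\<forall>f\<in>D. \<exists>V\<in>insert {} (hyperedges (g_out \<rho>\<^sub>0)). set (snd f) \<subseteq> insert d (K \<union> \<theta> ` V))" for \<theta> d
  proof -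
    \<comment> \<open>Variables outside the head disappear in \<open>g_out\<close>, and no hyperedge
      can account for their values; they are sent to \<open>d\<close>.\<close>
    define \<theta>' where "\<theta>' = (\<lambda>y. if y \<in> atom_vars (head \<rho>\<^sub>0) then \<theta> y else d)"
    \<comment> \<open>Pulling back along \<open>\<sigma>\<close> gives one valuation for
      \<open>R\<close> and all the \<open>\<rho>s\<close> simultaneously.\<close>
    define \<tau> where "\<tau> = (\<lambda>x. inst \<theta>' d (\<sigma> x))"
    have \<tau>: "inst_atom \<tau> d a = inst_atom \<theta>' d (subst_atom \<sigma> a)" for a :: "('p, 'v, 'c) atom"
      by (simp add: inst_atom_subst_atom \<tau>_def)
    obtain D where D: "\<And>\<rho>. \<rho> \<in> set \<rho>s \<Longrightarrow> edb_instance E (D \<rho>)"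
      "\<And>\<rho>. \<rho> \<in> set \<rho>s \<Longrightarrow> inst_atom \<tau> d (head \<rho>) \<in> model P (D \<rho>)"
      "\<And>\<rho> f. \<rho> \<in> set \<rho>s \<Longrightarrow> f \<in> D \<rho> \<Longrightarrow>
         \<exists>V\<in>insert {} (hyperedges \<rho>). set (snd f) \<subseteq> insert d (C \<rho> \<union> \<tau> ` V)"
      using C(2)[of _ \<tau> d] by metis
    define DD where "DD = (\<Union>\<rho>\<in>set \<rho>s. D \<rho>) \<union> inst_atom \<tau> d ` set es"
    have es_E: "fst a \<in> E" if "a \<in> set es" for a
      using that R schema by (auto simp: es edb_schema_def preds_def atoms_def)
    have "edb_instance E DD"
      using D(1) es_E by (auto simp: edb_instance_def DD_def inst_atom_def)
    moreover have "inst_atom \<theta> d (head (g_out \<rho>\<^sub>0)) \<in> model P DD"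
    proof (rule model.rule[OF R])
      have "inst_atom \<theta> d (head (g_out \<rho>\<^sub>0)) = inst_atom \<theta>' d (head \<rho>\<^sub>0)"
        by (auto simp: \<theta>'_def intro: inst_atom_cong)
      also have "\<dots> = inst_atom \<tau> d (head R)"
        by (simp add: \<rho>\<^sub>0 \<tau>)
      finally show "matches \<tau> (head R) (inst_atom \<theta> d (head (g_out \<rho>\<^sub>0)))"
        by (simp add: matches_inst_atom)
      have "inst_atom \<tau> d a \<in> model P DD" if "a \<in> set (body R)" for a
      proof (cases "fst a \<in> idb P")
        case True
        then have "a \<in> set as"
          using that by (simp add: as)
        then obtain i where i: "i < length as" "a = as ! i"
          by (auto simp: in_set_conv_nth)
        define \<rho> where "\<rho> = \<rho>s ! i"
        have i': "i < length \<rho>s" "fst (head \<rho>) = fst a"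
          using \<rho>s i by (auto simp: list_all2_conv_all_nth \<rho>_def)
        then have \<rho>: "\<rho> \<in> set \<rho>s"
          by (simp add: \<rho>_def)
        have "(snd a, snd (head \<rho>)) \<in> set (zip (map snd as) (map (\<lambda>\<rho>. snd (head \<rho>)) \<rho>s))"
          using i i' by (force simp: in_set_conv_nth \<rho>_def)
        then have "map (subst \<sigma>) (snd a) = map (subst \<sigma>) (snd (head \<rho>))"
          using unif by (auto simp: unifier_def)
        then have "subst_atom \<sigma> a = subst_atom \<sigma> (head \<rho>)"
          using i'(2) by (simp add: subst_atom_def)
        then have "inst_atom \<tau> d a = inst_atom \<tau> d (head \<rho>)"
          by (simp add: \<tau>)
        moreover have "D \<rho> \<subseteq> DD"
          using \<rho> by (auto simp: DD_def)
        ultimately show ?thesis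
          using D(2)[OF \<rho>] by (simp add: model_mono)
      next
        case False
        then have "inst_atom \<tau> d a \<in> DD"
          using that by (simp add: DD_def es)
        then show ?thesis
          by (rule model.edb)
      qed
      then show "\<forall>a\<in>set (body R). \<exists>f'. f' \<in> model P DD \<and> matches \<tau> a f'"
        by (metis matches_inst_atom)
    qed
    moreover have "\<exists>V\<in>insert {} (hyperedges (g_out \<rho>\<^sub>0)). set (snd f) \<subseteq> insert d (K \<union> \<theta> ` V)"
      if f: "f \<in> DD" for f
    proof -
      \<comment> \<open>After substitution each term is a constant in \<open>K\<close>, a wildcard
        or non-head variable with value \<open>d\<close>, or a head variable that
        \<open>g_out\<close> keeps within one hyperedge.\<close>
      have cover: "\<exists>V\<in>insert {} (hyperedges (g_out \<rho>\<^sub>0)).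
          inst \<theta>' d ` subst \<sigma> ` set (snd a) \<subseteq> insert d (K \<union> \<theta> ` V)"
        if "a \<in> set (concat (map body \<rho>s) @ es)" for a
      proof -
        have mem: "subst_atom \<sigma> a \<in> set (body \<rho>\<^sub>0)"
          using that by (auto simp: \<rho>\<^sub>0)
        obtain V where V: "V \<in> insert {} (hyperedges (g_out \<rho>\<^sub>0))"
          "atom_vars (subst_atom \<sigma> a) \<inter> atom_vars (head \<rho>\<^sub>0) \<subseteq> V"
          using g_out_keeps_head_vars[OF mem] by blast
        have "inst \<theta>' d t \<in> insert d (K \<union> \<theta> ` V)" if "t \<in> set (snd (subst_atom \<sigma> a))" for t
        proof (cases t)
          case (Var y)
          then show ?thesis
            using that V(2) by (auto simp: \<theta>'_def atom_vars_def)
        next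
          case (Cst c)
          then show ?thesis
            using that mem by (auto simp: K_def)
        qed simp
        then show ?thesis
          using V(1) by (intro bexI[of _ V]) (auto simp: subst_atom_def)
      qed
      consider (adorned) \<rho> where "\<rho> \<in> set \<rho>s" "f \<in> D \<rho>" | (edb) a where "a \<in> set es" "f = inst_atom \<tau> d a"
        using f by (auto simp: DD_def)
      then show ?thesis
      proof cases
        case adorned
        then have CK: "C \<rho> \<subseteq> K"
          by (auto simp: K_def)
        obtain V where V: "V \<in> insert {} (hyperedges \<rho>)" "set (snd f) \<subseteq> insert d (C \<rho> \<union> \<tau> ` V)"
          using D(3)[OF adorned] by blast
        show ?thesis
        proof (cases "V = {}")
          case True
          with V CK show ?thesis
            by (intro bexI[of _ "{}"]) auto
        next
          case False
          then obtain b where b: "b \<in> set (body \<rho>)" "V = atom_vars b"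
            using V(1) by (auto simp: hyperedges_def)
          have "b \<in> set (concat (map body \<rho>s) @ es)"
            using b(1) adorned(1) by auto
          from cover[OF this] obtain W where W: "W \<in> insert {} (hyperedges (g_out \<rho>\<^sub>0))"
            "inst \<theta>' d ` subst \<sigma> ` set (snd b) \<subseteq> insert d (K \<union> \<theta> ` W)"
            by (rule bexE)
          \<comment> \<open>All variables of \<open>V\<close> sit in the single atom
            \<open>b\<close>, whose image is one body atom of \<open>\<rho>\<^sub>0\<close>; hence
            one hyperedge \<open>W\<close> serves for the whole fact.\<close>
          have "\<tau> ` V \<subseteq> inst \<theta>' d ` subst \<sigma> ` set (snd b)"
            by (force simp: b(2) atom_vars_def \<tau>_def)
          also note W(2)
          finally have "insert d (C \<rho> \<union> \<tau> ` V) \<subseteq> insert d (K \<union> \<theta> ` W)"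
            using CK by blast
          with V(2) have "set (snd f) \<subseteq> insert d (K \<union> \<theta> ` W)"
            by (rule subset_trans)
          then show ?thesis
            using W(1) by (rule bexI)
        qed
      next
        case edb
        have "set (snd f) = inst \<theta>' d ` subst \<sigma> ` set (snd a)"
          by (simp add: edb inst_atom_def image_image inst_subst \<tau>_def)
        then show ?thesis
          using cover[of a] edb by auto
      qed
    qed
    ultimately show ?thesis
      by blast
  qed
  ultimately show ?thesis
    unfolding realizable_def by blast
qed

text \<open>Up to renaming, an adornment occurring in the new rule is one of the
  \<open>\<rho>s\<close> taken from \<open>P'\<close>, or the relaxed \<open>\<rho>\<^sub>0\<close>
  in its head.\<close>

lemma candidate_realizable:
  assumes "candidate g_out P P' R'" and "edb_schema E P"
    and "\<And>\<rho>. Adorned (adorn \<rho>) \<in> preds P' \<Longrightarrow> realizable E P \<rho>"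
    and "Adorned (adorn \<rho>) \<in> fst ` atoms R'"
  shows "realizable E P \<rho>"
  using assms(1)
proof cases
  case (1 R as es \<rho>s \<sigma> \<rho>\<^sub>0)
  have real: "list_all2 (\<lambda>a \<rho>. fst (head \<rho>) = fst a \<and> realizable E P \<rho>) as \<rho>s"
    by (rule list_all2_mono[OF 1(4)]) (force intro: assms(3) simp: preds_def atoms_def)
  then have "\<forall>\<rho>\<in>set \<rho>s. realizable E P \<rho>"
    by (auto simp: list_all2_conv_all_nth in_set_conv_nth)
  moreover have "realizable E P (g_out \<rho>\<^sub>0)"
    using 1(6) by (intro realizable_g_out[OF assms(2) 1(1-3) real _ 1(7)]) (simp add: mgu_def)
  moreover have "\<exists>\<rho>'\<in>insert (g_out \<rho>\<^sub>0) (set \<rho>s). adorn \<rho> = adorn \<rho>'"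
    using assms(4) by (auto simp: 1(8) atoms_def dest: set_zip_leftD)
  ultimately show ?thesis
    by (metis adornment.abs_eq_iff insert_iff realizable_variant)
qed

text \<open>Induction along the run: each step inserts one candidate.\<close>

lemma adornment_output_realizable:
  assumes "adornment_output g_out h P P'" and "edb_schema E P"
    and "Adorned (adorn \<rho>) \<in> preds P'"
  shows "realizable E P \<rho>"
proof -
  have "(adornment_step g_out h P)\<^sup>*\<^sup>* {} P'"
    using assms(1) by (simp add: adornment_output_def)
  then have "\<forall>\<rho>. Adorned (adorn \<rho>) \<in> preds P' \<longrightarrow> realizable E P \<rho>"
  proof induction
    case base
    then show ?case
      by (simp add: preds_def)
  next
    case (step Q Q')
    then obtain R' where R': "candidate g_out P Q R'" "Q' = insert R' Q"
      by (auto simp: adornment_step_def)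
    have "preds Q' = fst ` atoms R' \<union> preds Q"
      by (auto simp: R'(2) preds_def)
    with step.IH candidate_realizable[OF R'(1) assms(2)] show ?case
      by auto
  qed
  with assms(3) show ?thesis
    by blast
qed

section \<open>Adornments of the competing program\<close>

lemma variant_head_consts:
  assumes "variant \<rho> \<rho>'" and "Cst c \<in> set (snd (head \<rho>'))"
  shows "Cst c \<in> set (snd (head \<rho>))"
proof -
  obtain \<pi> where "head \<rho>' = subst_atom (Var \<circ> \<pi>) (head \<rho>)"
    using assms(1) unfolding variant_def by blast
  moreover have "subst (Var \<circ> \<pi>) t = Cst c \<Longrightarrow> t = Cst c" for t
    by (cases t) auto
  ultimately show ?thesis
    using assms(2) by (force simp: subst_atom_def)
qed

text \<open>Renaming leaves constants alone, so ranging over all representatives of a class gives no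
  more constants than a single one.\<close>

lemma finite_adornment_consts:
  "finite {c. \<exists>\<rho>. A = Adorned (adorn \<rho>) \<and> Cst c \<in> set (snd (head \<rho>))}" (is "finite ?S")
proof (cases "\<exists>\<rho>\<^sub>0. A = Adorned (adorn \<rho>\<^sub>0)")
  case True
  then obtain \<rho>\<^sub>0 where "A = Adorned (adorn \<rho>\<^sub>0)"
    by blast
  then have "?S \<subseteq> {c. Cst c \<in> set (snd (head \<rho>\<^sub>0))}"
    using variant_head_consts by (auto simp: adornment.abs_eq_iff)
  then show ?thesis
    by (rule finite_subset) (rule finite_consts)
qed simp

lemma variant_head_pred: "variant \<rho> \<rho>' \<Longrightarrow> fst (head \<rho>') = fst (head \<rho>)"
  by (auto simp: variant_def subst_atom_def)

text \<open>EDB-boundedness of the last rule applied yields a derivation by the adornment alone. Its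
  head predicate is outside \<open>E\<close> and its body predicates are in \<open>E\<close>, so
  that derivation is a single step from facts of \<open>D\<close>.\<close>

lemma edb_bounded_matches:
  assumes bounded: "edb_bounded E P''" and D: "edb_instance E D"
    and derived: "(Adorned (adorn \<rho>), cs) \<in> model P'' (edb_facts D)"
  obtains R \<rho>' \<theta> where "R \<in> P''" "fst (head R) = Adorned (adorn \<rho>')"
    "fst (head \<rho>') = fst (head \<rho>)" "plain (head \<rho>')" "matches \<theta> (head \<rho>') (fst (head \<rho>), cs)"
    "\<forall>a\<in>set (body \<rho>'). \<exists>f\<in>D. matches \<theta> a f"
proof -
  have "\<exists>R. derived_by P'' (edb_facts D) R (Adorned (adorn \<rho>), cs)"
    using derived
  proof cases
    case edb
    then show ?thesis
      by (auto simp: edb_facts_def)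
  next
    case (rule R \<theta>)
    then show ?thesis
      unfolding derived_by_def by blast
  qed
  then obtain R where R: "derived_by P'' (edb_facts D) R (Adorned (adorn \<rho>), cs)"
    by blast
  then have "R \<in> P''" and head: "fst (head R) = Adorned (adorn \<rho>)"
    by (auto simp: derived_by_def matches_def)
  then have "edb_adorned_atom E (head R)"
    using bounded by (force simp: edb_bounded_def edb_adorned_program_def atoms_def)
  \<comment> \<open>The given \<open>\<rho>\<close> is an arbitrary representative; the head atom of
    \<open>R\<close> supplies a valid one.\<close>
  then obtain \<rho>' where \<rho>': "adorn \<rho>' = adorn \<rho>" "valid_adornment E \<rho>'"
    using head by (auto simp: edb_adorned_atom_def)
  then have pred: "fst (head \<rho>') = fst (head \<rho>)"
    by (metis adornment.abs_eq_iff variant_head_pred)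
  have notin: "fst (head \<rho>') \<notin> E"
    using \<rho>'(2) by (simp add: valid_adornment_def)
  have in_D: "f \<in> D" if "f \<in> model {\<rho>'} D" "fst f \<in> E" for f
    using that(1) by cases (use that(2) notin in \<open>auto simp: matches_def\<close>)
  have "cs \<in> answers (fst (head \<rho>')) {\<rho>'} D"
    using bounded D R head \<open>R \<in> P''\<close> \<rho>'(1) by (simp add: edb_bounded_def)
  then have "(fst (head \<rho>), cs) \<in> model {\<rho>'} D"
    by (simp add: answers_def pred)
  then obtain \<theta> where \<theta>: "matches \<theta> (head \<rho>') (fst (head \<rho>), cs)"
    "\<forall>a\<in>set (body \<rho>'). \<exists>f. f \<in> model {\<rho>'} D \<and> matches \<theta> a f"
    using D notin by cases (auto simp: edb_instance_def pred)
  have "\<exists>f\<in>D. matches \<theta> a f" if "a \<in> set (body \<rho>')" for a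
  proof -
    have "fst a \<in> E"
      using \<rho>'(2) that by (auto simp: valid_adornment_def)
    then show ?thesis
      using \<theta>(2) that in_D by (metis matches_def)
  qed
  with that[OF \<open>R \<in> P''\<close> _ pred _ \<theta>(1)] show thesis
    using head \<rho>' by (simp add: valid_adornment_def)
qed

section \<open>Transferring edge covers\<close>

lemma fresh_valuation:
  fixes K :: "'c::infinite set"
  assumes "finite X" and "finite K"
  obtains \<theta> :: "'v \<Rightarrow> 'c" and d where "inj_on \<theta> X" "\<theta> ` X \<inter> K = {}" "d \<notin> \<theta> ` X"
proof -
  have "infinite (- K)"
    using assms(2) by (simp add: Compl_eq_Diff_UNIV infinite_UNIV)
  then obtain B where B: "finite B" "card B = card X" "B \<subseteq> - K"
    using infinite_arbitrarily_large by metis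
  then obtain \<theta> where \<theta>: "bij_betw \<theta> X B"
    using finite_same_card_bij assms(1) by metis
  obtain d where "d \<notin> B"
    using B(1) ex_new_if_finite infinite_UNIV by blast
  with \<theta> B(3) show thesis
    by (intro that[of \<theta> d]) (auto simp: bij_betw_def)
qed

theorem theorem5p8:
  fixes P :: "('p, 'v::infinite, 'c::infinite) rule set"
    and E :: "'p set"
    and P' P'' :: "('p, 'v, 'c) arule set"
    and q :: 'p
  assumes "datalog_program P"
    and "edb_schema E P"
    and "adornment_output g_out h_eq P P'"
    and "q \<in> idb P"
    and "edb_bounded E P''"
    and "equivalent E P'' P"
  shows "ew_program P' q \<le> ew_program P'' q"
  unfolding ew_program_def[of P']
proof (rule SUP_least)
  fix \<rho> :: "('p, 'v, 'c) rule"
  assume "\<rho> \<in> {\<rho>. Adorned (adorn \<rho>) \<in> preds P' \<and> fst (head \<rho>) = q}"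
  then have pred: "fst (head \<rho>) = q" and "realizable E P \<rho>"
    using adornment_output_realizable[OF assms(3,2)] by auto
  then obtain C where C: "finite C" "\<And>\<theta> d. \<exists>D. edb_instance E D \<and>
     inst_atom \<theta> d (head \<rho>) \<in> model P D \<and>
     (\<forall>f\<in>D. \<exists>V\<in>insert {} (hyperedges \<rho>). set (snd f) \<subseteq> insert d (C \<union> \<theta> ` V))"
    unfolding realizable_def by blast
  \<comment> \<open>Constants in the adornment heads of \<open>P''\<close>. Values outside
    \<open>K\<close> cannot be produced by a constant in such a head, only by a variable.\<close>
  define K where
    "K = (\<Union>R\<in>P''. {c. \<exists>\<rho>. fst (head R) = Adorned (adorn \<rho>) \<and> Cst c \<in> set (snd (head \<rho>))})"
  have "finite P''"
    using assms(5) by (simp add: edb_bounded_def edb_adorned_program_def datalog_program_def)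
  then have "finite (C \<union> K)"
    using C(1) by (simp add: K_def finite_adornment_consts)
  then obtain \<theta> :: "'v \<Rightarrow> 'c" and d where \<theta>: "inj_on \<theta> (rule_vars \<rho>)"
    "\<theta> ` rule_vars \<rho> \<inter> (C \<union> K) = {}" "d \<notin> \<theta> ` rule_vars \<rho>"
    using fresh_valuation[OF finite_rule_vars] by metis
  define cs where "cs = map (inst \<theta> d) (snd (head \<rho>))"
  obtain D where D: "edb_instance E D" "(q, cs) \<in> model P D"
    "\<forall>f\<in>D. \<exists>V\<in>insert {} (hyperedges \<rho>). set (snd f) \<subseteq> insert d (C \<union> \<theta> ` V)"
    using C(2)[of \<theta> d] pred by (auto simp: inst_atom_def cs_def)
  have "answers q P D =
      (\<Union>\<rho>\<in>{\<rho>. fst (head \<rho>) = q}. answers (Adorned (adorn \<rho>)) P'' (edb_facts D))"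
    using assms(4,6) D(1) by (simp add: equivalent_def)
  with D(2) obtain \<rho>\<^sub>1 where \<rho>\<^sub>1: "fst (head \<rho>\<^sub>1) = q" "(Adorned (adorn \<rho>\<^sub>1), cs) \<in> model P'' (edb_facts D)"
    by (auto simp: answers_def)
  obtain R \<rho>'' \<eta> where R: "R \<in> P''" "fst (head R) = Adorned (adorn \<rho>'')"
    and \<rho>'': "fst (head \<rho>'') = q" "plain (head \<rho>'')" "matches \<eta> (head \<rho>'') (q, cs)"
    "\<forall>a\<in>set (body \<rho>''). \<exists>f\<in>D. matches \<eta> a f"
    using edb_bounded_matches[OF assms(5) D(1) \<rho>\<^sub>1(2)] \<rho>\<^sub>1(1) by metis
  \<comment> \<open>A hyperedge is matched into a single fact of \<open>D\<close>, and such a fact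
    shows values from at most one hyperedge of \<open>\<rho>\<close>.\<close>
  have "\<forall>e\<in>hyperedges \<rho>''. \<exists>V\<in>insert {} (hyperedges \<rho>). \<eta> ` e \<subseteq> insert d (C \<union> \<theta> ` V)"
  proof
    fix e
    assume "e \<in> hyperedges \<rho>''"
    then obtain a f where "e = atom_vars a" "f \<in> D" "matches \<eta> a f"
      using \<rho>''(4) by (auto simp: hyperedges_def)
    then have "\<eta> ` e \<subseteq> set (snd f)" "f \<in> D"
      using matches_var by fastforce+
    then show "\<exists>V\<in>insert {} (hyperedges \<rho>). \<eta> ` e \<subseteq> insert d (C \<union> \<theta> ` V)"
      using D(3) by (meson subset_trans)
  qed
  then obtain W where W: "\<And>e. e \<in> hyperedges \<rho>'' \<Longrightarrow> W e \<in> insert {} (hyperedges \<rho>)"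
    "\<And>e. e \<in> hyperedges \<rho>'' \<Longrightarrow> \<eta> ` e \<subseteq> insert d (C \<union> \<theta> ` W e)"
    by metis
  have "ew \<rho> \<le> enat (card F)"
    if F: "F \<subseteq> hyperedges \<rho>''" "atom_vars (head \<rho>'') \<subseteq> \<Union> F" for F
  proof -
    \<comment> \<open>The intersection discards the default \<open>{}\<close> among the sets
      \<open>W e\<close>; this can only lower the cardinality.\<close>
    define G where "G = W ` F \<inter> hyperedges \<rho>"
    have "finite F"
      using F(1) by (rule finite_subset) (simp add: hyperedges_def)
    then have "card G \<le> card F"
      unfolding G_def by (meson card_image_le card_mono finite_imageI inf_le1 le_trans)
    moreover have "x \<in> \<Union> G" if x: "x \<in> atom_vars (head \<rho>)" for x
    proof -
      have xv: "x \<in> rule_vars \<rho>"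
        using x by (auto simp: rule_vars_def atoms_def)
      obtain i where i: "i < length (snd (head \<rho>))" "snd (head \<rho>) ! i = Var x"
        using x by (auto simp: atom_vars_def in_set_conv_nth)
      let ?t = "snd (head \<rho>'') ! i"
      have t: "?t \<in> set (snd (head \<rho>''))" "match_trm \<eta> ?t (\<theta> x)"
        using matches_nth[OF \<rho>''(3), of i] i by (auto simp: cs_def)
      have "?t \<noteq> Cst (\<theta> x)"
        using \<theta>(2) xv t(1) R by (auto simp: K_def)
      moreover have "?t \<noteq> Wild"
        using \<rho>''(2) t(1) by (metis plain_def)
      ultimately obtain y where y: "?t = Var y" "\<eta> y = \<theta> x"
        using t(2) by (cases ?t) auto
      then obtain e where e: "e \<in> F" "y \<in> e"
        using t(1) F(2) by (auto simp: atom_vars_def)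
      then have "\<theta> x \<in> \<eta> ` e"
        by (simp flip: y(2))
      then have "\<theta> x \<in> insert d (C \<union> \<theta> ` W e)"
        using W(2)[of e] F(1) e(1) by blast
      \<comment> \<open>Freshness excludes \<open>d\<close> and \<open>C\<close>, so the value stems
        from a variable in \<open>W e\<close>.\<close>
      then have "\<theta> x \<in> \<theta> ` W e"
        using \<theta>(2,3) xv by auto
      moreover have "W e \<in> insert {} (hyperedges \<rho>)"
        using W(1) e(1) F(1) by auto
      moreover from this have "W e \<subseteq> rule_vars \<rho>"
        by (auto simp: hyperedges_def rule_vars_def atoms_def)
      \<comment> \<open>Injectivity identifies that variable with \<open>x\<close>; thus
        \<open>W e\<close> is nonempty and a genuine hyperedge of \<open>\<rho>\<close>.\<close>
      ultimately have "x \<in> W e" "W e \<in> hyperedges \<rho>"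
        using \<theta>(1) xv by (auto simp: inj_on_def)
      then show ?thesis
        using e(1) by (auto simp: G_def)
    qed
    moreover have "G \<subseteq> hyperedges \<rho>"
      by (simp add: G_def)
    ultimately show ?thesis
      unfolding ew_def
      by (intro INF_lower2[of G]) auto
  qed
  then have "ew \<rho> \<le> ew \<rho>''"
    unfolding ew_def[of \<rho>''] by (intro INF_greatest) simp
  also have "\<dots> \<le> ew_program P'' q"
    unfolding ew_program_def
    using R \<rho>''(1) by (intro SUP_upper) (force simp: preds_def atoms_def)
  finally show "ew \<rho> \<le> ew_program P'' q" .
qed

end
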